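(* Let $\dagger : \mathbb{G}(P)\times \mathcal{L}_0(P) \rightarrow \mathbb{G}(P)$ be a relevant P-graph transformation. Suppose that for every P-graph $G = \langle \Phi, \prec\rangle$ and every propositional formula $\varphi \in \mathcal{L}_0(P)$, the P-graph $\dagger(G,\varphi)= \langle \Phi_\dagger, \prec_\dagger\rangle$ satisfies both of the following conditions. 1. For all $\xi \in \Phi$ there is some $\xi' \in \Phi_\dagger$ such that (a) $\neg\varphi \wedge \xi \equiv \neg\varphi \wedge \xi'$, and (b) for all $\psi \in \Phi$, if $\psi \prec \xi$ then there is $\psi' \in \Phi_\dagger$ such that $\neg\varphi \wedge \psi \equiv \neg\varphi \wedge \psi'$ and $\psi'\prec_\dagger \xi'$. 2. For all $\xi \in \Phi_\dagger$, either $\xi \equiv \varphi$, or there is some $\xi' \in \Phi$ such that (a) $\neg\varphi \wedge \xi \equiv \neg\varphi \wedge \xi'$, and (b) for all $\psi \in \Phi_\dagger$, if $\psi \prec_\dagger \xi$ then either $\psi\equiv \varphi$, or there is $\psi' \in \Phi$ such that $\neg\varphi \wedge \psi \equiv \neg\varphi \wedge \psi'$ and $\psi'\prec \xi'$. Then $\dagger$ satisfies DP-2; that is, for every dynamic operator $\star$ induced by $\dagger$, every preference model $M=\langle W,\leq,v\rangle$ that is induced by some P-graph, every $\varphi\in\mathcal{L}_0(P)$, writing $\star(M,\varphi)=\langle W,\leq_{\star\varphi},v\rangle$, and all $w,w'\in W$: if $w\not\vDash\varphi$ and $w'\not\vDash\varphi$, then $w\leq_{\star\varphi} w'$ if and only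 if $w\leq w'$.
   Context: $P$ is a countable set of propositional symbols and $\mathcal{L}_0(P)$ is the set of classical propositional formulas over $P$; $\equiv$ is classical logical equivalence. P-graph: a pair $G=\langle\Phi,\prec\rangle$ with $\Phi\subseteq\mathcal{L}_0(P)$ and $\prec$ a strict partial order on $\Phi$. $\mathbb{G}(P)$ is the set of all P-graphs over $P$. Given a non-empty set $W$ of worlds and a valuation $v:P\to 2^W$, $w\vDash\varphi$ denotes classical satisfaction of $\varphi$ at $w$ (with $w\vDash p$ iff $w\in v(p)$). The relation $\leq_G$ on $W$ is: $w\leq_G w'$ iff for every $\varphi\in\Phi$, either ($w'\vDash\varphi$ implies $w\vDash\varphi$), or there is $\psi\in\Phi$ with $\psi\prec\varphi$, $w\vDash\psi$ and $w'\not\vDash\psi$. Preference model: $M=\langle W,\leq,v\rangle$ with $W$ a non-empty set, $v:P\to 2^W$, and $\leq$ a reflexive transitive relation on $W$ whose strict part $<$ ($w<w'$ iff $w\leq w'$ and not $w'\leq w$) is well-founded. $M$ is induced by a P-graph $G$ iff $\leq\;=\;\leq_G$ (computed with $W$ and $v$). Dynamic operator: a function $\star$ mapping each pair (preference model $\langle W,\leq,v\rangle$, formula $\varphi\in\mathcal{L}_0(P)$) to a preference model $\langle W,\leq_{\star\varphi},v\rangle$ with the same $W$ and $v$. P-graph transformation: any function $\dagger:\mathbb{G}(P)\times\mathcal{L}_0(P)\to\mathbb{G}(P)$. A dynamic operator $\star$ is induced by $\dagger$ if for all preference models $M$, P-graphs $G$ and formulas $\varphi\in\mathcal{L}_0(P)$: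 if $M$ is induced by $G$ then $\star(M,\varphi)$ is induced by $\dagger(G,\varphi)$. $\dagger$ is relevant if some dynamic operator is induced by it. *)

theory Defs
  imports Main "HOL-Library.Countable"
begin

datatype 'p fm =
    Atom 'p
  | Falsum  (\<open>\<^bold>\<bottom>\<close>)
  | Neg "'p fm"  (\<open>\<^bold>\<not> _\<close> [70] 70)
  | Conj "'p fm" "'p fm"  (infixr \<open>\<^bold>\<and>\<close> 65)
  | Disj "'p fm" "'p fm"  (infixr \<open>\<^bold>\<or>\<close> 60)
  | Impl "'p fm" "'p fm"  (infixr \<open>\<^bold>\<longrightarrow>\<close> 55)

primrec holds :: "('p \<Rightarrow> bool) \<Rightarrow> 'p fm \<Rightarrow> bool" where
  "holds I (Atom p) \<longleftrightarrow> I p"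
| "holds I \<^bold>\<bottom> \<longleftrightarrow> False"
| "holds I (\<^bold>\<not> \<phi>) \<longleftrightarrow> \<not> holds I \<phi>"
| "holds I (\<phi> \<^bold>\<and> \<psi>) \<longleftrightarrow> holds I \<phi> \<and> holds I \<psi>"
| "holds I (\<phi> \<^bold>\<or> \<psi>) \<longleftrightarrow> holds I \<phi> \<or> holds I \<psi>"
| "holds I (\<phi> \<^bold>\<longrightarrow> \<psi>) \<longleftrightarrow> (holds I \<phi> \<longrightarrow> holds I \<psi>)"

definition fm_equiv :: "'p fm \<Rightarrow> 'p fm \<Rightarrow> bool"  (infix \<open>\<simeq>\<close> 50) where
  "\<phi> \<simeq> \<psi> \<longleftrightarrow> (\<forall>I. holds I \<phi> \<longleftrightarrow> holds I \<psi>)"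

definition sat :: "('p \<Rightarrow> 'w set) \<Rightarrow> 'w \<Rightarrow> 'p fm \<Rightarrow> bool" where
  "sat v w \<phi> \<longleftrightarrow> holds (\<lambda>p. w \<in> v p) \<phi>"

(* The pair (psi, phi) belongs to prec G iff psi precedes phi; likewise (w, w')
   belongs to the relation le M of a model iff w is below w'. *)
record 'p pgraph =
  fms :: "'p fm set"
  prec :: "'p fm rel"

definition is_pgraph :: "'p pgraph \<Rightarrow> bool" where
  "is_pgraph G \<longleftrightarrow>
     prec G \<subseteq> fms G \<times> fms G \<and> irrefl_on (fms G) (prec G) \<and> trans_on (fms G) (prec G)"

definition le_of :: "'p pgraph \<Rightarrow> 'w set \<Rightarrow> ('p \<Rightarrow> 'w set) \<Rightarrow> 'w rel" where
  "le_of G W v = {(w, w') \<in> W \<times> W. \<forall>\<phi>\<in>fms G.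
     (sat v w' \<phi> \<longrightarrow> sat v w \<phi>) \<or>
     (\<exists>\<psi>\<in>fms G. (\<psi>, \<phi>) \<in> prec G \<and> sat v w \<psi> \<and> \<not> sat v w' \<psi>)}"

record ('w, 'p) model =
  worlds :: "'w set"
  le :: "'w rel"
  val :: "'p \<Rightarrow> 'w set"

definition pref_model :: "('w, 'p) model \<Rightarrow> bool" where
  "pref_model M \<longleftrightarrow>
     worlds M \<noteq> {} \<and> (\<forall>p. val M p \<subseteq> worlds M) \<and> preorder_on (worlds M) (le M) \<and>
     wf {(w, w'). (w, w') \<in> le M \<and> (w', w) \<notin> le M}"

definition model_induced_by :: "('w, 'p) model \<Rightarrow> 'p pgraph \<Rightarrow> bool" where
  "model_induced_by M G \<longleftrightarrow> le M = le_of G (worlds M) (val M)"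

(* Operators and transformations are total functions on the underlying record
   types; only their behaviour on genuine preference models and P-graphs is
   constrained or used. *)
definition dynamic_operator :: "(('w, 'p) model \<Rightarrow> 'p fm \<Rightarrow> ('w, 'p) model) \<Rightarrow> bool" where
  "dynamic_operator star \<longleftrightarrow>
     (\<forall>M \<phi>. pref_model M \<longrightarrow>
        pref_model (star M \<phi>) \<and> worlds (star M \<phi>) = worlds M \<and> val (star M \<phi>) = val M)"

definition pgraph_transformation :: "('p pgraph \<Rightarrow> 'p fm \<Rightarrow> 'p pgraph) \<Rightarrow> bool" where
  "pgraph_transformation dagger \<longleftrightarrow> (\<forall>G \<phi>. is_pgraph G \<longrightarrow> is_pgraph (dagger G \<phi>))"

definition operator_induced_by ::
  "(('w, 'p) model \<Rightarrow> 'p fm \<Rightarrow> ('w, 'p) model) \<Rightarrow> ('p pgraph \<Rightarrow> 'p fm \<Rightarrow> 'p pgraph) \<Rightarrow> bool" where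
  "operator_induced_by star dagger \<longleftrightarrow>
     (\<forall>M G \<phi>. pref_model M \<longrightarrow> is_pgraph G \<longrightarrow> model_induced_by M G \<longrightarrow>
        model_induced_by (star M \<phi>) (dagger G \<phi>))"

(* Both notions below quantify over operators on models whose worlds are drawn
   from the type 'w, hence the type argument. *)
definition relevant :: "'w itself \<Rightarrow> ('p pgraph \<Rightarrow> 'p fm \<Rightarrow> 'p pgraph) \<Rightarrow> bool" where
  "relevant (_ :: 'w itself) dagger \<longleftrightarrow>
     (\<exists>star :: ('w, 'p) model \<Rightarrow> 'p fm \<Rightarrow> ('w, 'p) model.
        dynamic_operator star \<and> operator_induced_by star dagger)"

definition satisfies_DP2 :: "'w itself \<Rightarrow> ('p pgraph \<Rightarrow> 'p fm \<Rightarrow> 'p pgraph) \<Rightarrow> bool" where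
  "satisfies_DP2 (_ :: 'w itself) dagger \<longleftrightarrow>
     (\<forall>star :: ('w, 'p) model \<Rightarrow> 'p fm \<Rightarrow> ('w, 'p) model.
        dynamic_operator star \<longrightarrow> operator_induced_by star dagger \<longrightarrow>
        (\<forall>M. pref_model M \<longrightarrow> (\<exists>G. is_pgraph G \<and> model_induced_by M G) \<longrightarrow>
           (\<forall>\<phi>. \<forall>w\<in>worlds M. \<forall>w'\<in>worlds M.
              \<not> sat (val M) w \<phi> \<longrightarrow> \<not> sat (val M) w' \<phi> \<longrightarrow>
              ((w, w') \<in> le (star M \<phi>) \<longleftrightarrow> (w, w') \<in> le M))))"

end

(* The conditions bound the predecessors of matching formulas only from one side each, so
   for a general P-graph G they do not by themselves make the two orders agree; relevance
   closes the gap.  Whether w is below w' only concerns the submodel on {w, w'}, and that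
   submodel is also induced by the flat P-graph (empty precedence) of all formulas monotone
   on it.  Relevance forces the two transformed graphs to agree on the submodel, and for a
   flat graph the two conditions do transfer the order between the worlds violating \<phi>. *)
theory Submission
  imports Defs
begin

text \<open>The valuation is cut down as well, since \<open>pref_model\<close> wants its values
  inside \<open>worlds\<close>.\<close>

definition restrict_model :: "('w, 'p) model \<Rightarrow> 'w set \<Rightarrow> ('w, 'p) model" where
  "restrict_model M S = \<lparr>worlds = S, le = le M \<inter> S \<times> S, val = (\<lambda>p. val M p \<inter> S)\<rparr>"

lemma restrict_model_simps [simp]:
  "worlds (restrict_model M S) = S"
  "le (restrict_model M S) = le M \<inter> S \<times> S"
  "val (restrict_model M S) = (\<lambda>p. val M p \<inter> S)"
  by (simp_all add: restrict_model_def)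

lemma sat_restrict: "x \<in> S \<Longrightarrow> sat (\<lambda>p. v p \<inter> S) x \<chi> \<longleftrightarrow> sat v x \<chi>"
  by (simp add: sat_def)

text \<open>Whether \<open>le_of\<close> relates two worlds depends only on the formulas true at
  these two.\<close>

lemma le_of_restrict:
  "S \<subseteq> W \<Longrightarrow> le_of G S (\<lambda>p. v p \<inter> S) = le_of G W v \<inter> S \<times> S"
  by (auto simp: le_of_def sat_restrict)

lemma pref_model_restrict:
  assumes M: "pref_model M" and "S \<subseteq> worlds M" "S \<noteq> {}"
  shows "pref_model (restrict_model M S)"
proof -
  have "wf {(x, y). (x, y) \<in> le M \<inter> S \<times> S \<and> (y, x) \<notin> le M \<inter> S \<times> S}"
    \<comment> \<open>A reverse pair absent from the restriction is absent from \<open>le M\<close>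
      too, as both worlds lie in \<open>S\<close>.\<close>
    by (rule wf_subset[where r = "{(x, y). (x, y) \<in> le M \<and> (y, x) \<notin> le M}"])
       (use M in \<open>auto simp: pref_model_def\<close>)
  moreover have "preorder_on S (le M \<inter> S \<times> S)"
    using M assms(2) by (auto simp: pref_model_def preorder_on_def refl_on_def intro!: transI dest: transD)
  ultimately show ?thesis
    using assms(3) by (simp add: pref_model_def)
qed

lemma model_induced_by_restrict:
  assumes "model_induced_by M G" "S \<subseteq> worlds M"
  shows "model_induced_by (restrict_model M S) G"
  using assms by (simp add: model_induced_by_def le_of_restrict)

definition flat_pgraph :: "('w, 'p) model \<Rightarrow> 'p pgraph" where
  "flat_pgraph M =
     \<lparr>fms = {\<chi>. \<forall>(x, y)\<in>le M. sat (val M) y \<chi> \<longrightarrow> sat (val M) x \<chi>}, prec = {}\<rparr>"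

lemma is_pgraph_flat: "is_pgraph (flat_pgraph M)"
  by (simp add: is_pgraph_def flat_pgraph_def irrefl_on_def trans_on_def)

(* With only two worlds, any formula refuting (x, y) in le_of G is monotone, as (y, x) is
   the only other non-reflexive pair.  With more worlds it need not be. *)
lemma two_worlds_induced_by_flat:
  assumes ind: "model_induced_by M G" and W: "worlds M = {w, w'}"
  shows "model_induced_by M (flat_pgraph M)"
  unfolding model_induced_by_def
proof (rule set_eqI, clarify)
  fix x y
  let ?R = "le_of (flat_pgraph M) (worlds M) (val M)"
  have M: "le M = le_of G (worlds M) (val M)"
    using ind by (simp add: model_induced_by_def)
  show "(x, y) \<in> le M \<longleftrightarrow> (x, y) \<in> ?R"
  proof
    assume "(x, y) \<in> le M"
    then show "(x, y) \<in> ?R"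
      using M by (auto simp: le_of_def flat_pgraph_def)
  next
    assume R: "(x, y) \<in> ?R"
    then have xy: "x \<in> worlds M" "y \<in> worlds M"
      by (auto simp: le_of_def)
    show "(x, y) \<in> le M"
    proof (rule ccontr)
      assume n: "(x, y) \<notin> le M"
      then obtain \<chi> where \<chi>: "sat (val M) y \<chi>" "\<not> sat (val M) x \<chi>"
        unfolding M using xy by (auto simp: le_of_def)
      \<comment> \<open>\<chi> separates \<open>x\<close> from \<open>y\<close>, so they are
        distinct and exhaust the worlds.\<close>
      have "worlds M = {x, y}"
        using W xy \<chi> by auto
      then have "le M \<subseteq> {x, y} \<times> {x, y}"
        unfolding M by (auto simp: le_of_def)
      then have "\<chi> \<in> fms (flat_pgraph M)"
        using n \<chi> by (auto simp: flat_pgraph_def)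
      then show False
        using R \<chi> by (auto simp: le_of_def flat_pgraph_def)
    qed
  qed
qed

lemma sat_equiv: "\<chi> \<simeq> \<phi> \<Longrightarrow> sat v x \<chi> \<longleftrightarrow> sat v x \<phi>"
  by (simp add: fm_equiv_def sat_def)

lemma sat_equiv_neg:
  "(\<^bold>\<not> \<phi> \<^bold>\<and> \<chi>) \<simeq> (\<^bold>\<not> \<phi> \<^bold>\<and> \<chi>') \<Longrightarrow> \<not> sat v x \<phi> \<Longrightarrow> sat v x \<chi> \<longleftrightarrow> sat v x \<chi>'"
  by (auto simp: fm_equiv_def sat_def)

text \<open>The assumptions \<open>to\<close> and \<open>fro\<close> are what the two conditions on
  a transformation yield when \<open>prec G\<close> is empty: a predecessor in \<open>H\<close> of a
  formula not equivalent to \<phi> has no counterpart in \<open>G\<close>, so it is itself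
  equivalent to \<phi>. At worlds violating \<phi>, both relations then amount to
  monotonicity.\<close>

lemma le_of_flat_transfer:
  assumes flat: "prec G = {}"
    and to: "\<And>\<xi>. \<xi> \<in> fms G \<Longrightarrow> \<exists>\<xi>'\<in>fms H. (\<^bold>\<not> \<phi> \<^bold>\<and> \<xi>) \<simeq> (\<^bold>\<not> \<phi> \<^bold>\<and> \<xi>')"
    and fro: "\<And>\<xi>. \<xi> \<in> fms H \<Longrightarrow>
      \<xi> \<simeq> \<phi> \<or>
      (\<exists>\<xi>'\<in>fms G.
        (\<^bold>\<not> \<phi> \<^bold>\<and> \<xi>) \<simeq> (\<^bold>\<not> \<phi> \<^bold>\<and> \<xi>') \<and>
        (\<forall>\<psi>\<in>fms H. (\<psi>, \<xi>) \<in> prec H \<longrightarrow> \<psi> \<simeq> \<phi>))"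
    and neg: "\<not> sat v x \<phi>" "\<not> sat v y \<phi>"
  shows "(x, y) \<in> le_of H W v \<longleftrightarrow> (x, y) \<in> le_of G W v"
proof
  assume H: "(x, y) \<in> le_of H W v"
  have "sat v x \<xi>" if \<xi>: "\<xi> \<in> fms G" "sat v y \<xi>" for \<xi>
  proof -
    obtain \<xi>' where \<xi>': "\<xi>' \<in> fms H" "(\<^bold>\<not> \<phi> \<^bold>\<and> \<xi>) \<simeq> (\<^bold>\<not> \<phi> \<^bold>\<and> \<xi>')"
      using to[OF \<xi>(1)] by auto
    have y: "sat v y \<xi>'"
      using sat_equiv_neg[OF \<xi>'(2) neg(2)] \<xi>(2) by simp
    \<comment> \<open>This rules out the first alternative of \<open>fro\<close>.\<close>
    then have "\<not> \<xi>' \<simeq> \<phi>"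
      using sat_equiv[of \<xi>' \<phi> v y] neg(2) by auto
    then have "\<psi> \<simeq> \<phi>" if "\<psi> \<in> fms H" "(\<psi>, \<xi>') \<in> prec H" for \<psi>
      using fro[OF \<xi>'(1)] that by auto
    \<comment> \<open>No predecessor of \<open>\<xi>'\<close> holds at \<open>x\<close>, so
      \<open>le_of H\<close> leaves only the implication from \<open>y\<close> to
      \<open>x\<close>.\<close>
    then have "\<not> sat v x \<psi>" if "\<psi> \<in> fms H" "(\<psi>, \<xi>') \<in> prec H" for \<psi>
      using that sat_equiv[of \<psi> \<phi> v x] neg(1) by auto
    then have "sat v x \<xi>'"
      using H y \<xi>'(1) by (auto simp: le_of_def)
    then show ?thesis
      using sat_equiv_neg[OF \<xi>'(2) neg(1)] by simp
  qed
  then show "(x, y) \<in> le_of G W v"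
    using H by (auto simp: le_of_def)
next
  assume G: "(x, y) \<in> le_of G W v"
  then have mono: "sat v y \<chi> \<Longrightarrow> sat v x \<chi>" if "\<chi> \<in> fms G" for \<chi>
    using that flat by (auto simp: le_of_def)
  have "sat v x \<xi>" if \<xi>: "\<xi> \<in> fms H" "sat v y \<xi>" for \<xi>
  proof -
    have "\<not> \<xi> \<simeq> \<phi>"
      using sat_equiv[of \<xi> \<phi> v y] \<xi>(2) neg(2) by auto
    then obtain \<xi>' where \<xi>': "\<xi>' \<in> fms G" "(\<^bold>\<not> \<phi> \<^bold>\<and> \<xi>) \<simeq> (\<^bold>\<not> \<phi> \<^bold>\<and> \<xi>')"
      using fro[OF \<xi>(1)] by auto
    show ?thesis
      using mono[OF \<xi>'(1)] \<xi>(2) sat_equiv_neg[OF \<xi>'(2) neg(1)] sat_equiv_neg[OF \<xi>'(2) neg(2)] by simp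
  qed
  then show "(x, y) \<in> le_of H W v"
    using G by (auto simp: le_of_def)
qed

theorem proposition12:
  fixes dagger :: "'p::countable pgraph \<Rightarrow> 'p fm \<Rightarrow> 'p pgraph"
  assumes "pgraph_transformation dagger"
    and "relevant TYPE('w) dagger"
    and "\<And>G \<phi> \<xi>. is_pgraph G \<Longrightarrow> \<xi> \<in> fms G \<Longrightarrow>
      \<exists>\<xi>'\<in>fms (dagger G \<phi>).
        (\<^bold>\<not> \<phi> \<^bold>\<and> \<xi>) \<simeq> (\<^bold>\<not> \<phi> \<^bold>\<and> \<xi>') \<and>
        (\<forall>\<psi>\<in>fms G. (\<psi>, \<xi>) \<in> prec G \<longrightarrow>
          (\<exists>\<psi>'\<in>fms (dagger G \<phi>).
            (\<^bold>\<not> \<phi> \<^bold>\<and> \<psi>) \<simeq> (\<^bold>\<not> \<phi> \<^bold>\<and> \<psi>') \<and> (\<psi>', \<xi>') \<in> prec (dagger G \<phi>)))"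
    and "\<And>G \<phi> \<xi>. is_pgraph G \<Longrightarrow> \<xi> \<in> fms (dagger G \<phi>) \<Longrightarrow>
      \<xi> \<simeq> \<phi> \<or>
      (\<exists>\<xi>'\<in>fms G.
        (\<^bold>\<not> \<phi> \<^bold>\<and> \<xi>) \<simeq> (\<^bold>\<not> \<phi> \<^bold>\<and> \<xi>') \<and>
        (\<forall>\<psi>\<in>fms (dagger G \<phi>). (\<psi>, \<xi>) \<in> prec (dagger G \<phi>) \<longrightarrow>
          \<psi> \<simeq> \<phi> \<or>
          (\<exists>\<psi>'\<in>fms G. (\<^bold>\<not> \<phi> \<^bold>\<and> \<psi>) \<simeq> (\<^bold>\<not> \<phi> \<^bold>\<and> \<psi>') \<and> (\<psi>', \<xi>') \<in> prec G)))"
  shows "satisfies_DP2 TYPE('w) dagger"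
  unfolding satisfies_DP2_def
proof (intro allI impI ballI)
  fix star :: "('w, 'p) model \<Rightarrow> 'p fm \<Rightarrow> ('w, 'p) model" and M :: "('w, 'p) model" and \<phi> w w'
  assume star: "dynamic_operator star" "operator_induced_by star dagger"
    and M: "pref_model M" "\<exists>G. is_pgraph G \<and> model_induced_by M G"
    and w: "w \<in> worlds M" "w' \<in> worlds M"
    and neg: "\<not> sat (val M) w \<phi>" "\<not> sat (val M) w' \<phi>"
  obtain G where G: "is_pgraph G" "model_induced_by M G"
    using M(2) by auto
  \<comment> \<open>The worlds may coincide; \<open>S\<close> is then a singleton and the argument
    is the same.\<close>
  define S where "S = {w, w'}"
  define N where "N = restrict_model M S"
  define F where "F = flat_pgraph N"
  have S: "S \<subseteq> worlds M" "w \<in> S" "w' \<in> S" "S \<noteq> {}"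
    using w by (auto simp: S_def)
  have N: "pref_model N" "model_induced_by N G"
    unfolding N_def using M G S by (simp_all add: pref_model_restrict model_induced_by_restrict)
  have F: "is_pgraph F" "prec F = {}"
    by (simp_all add: F_def is_pgraph_flat) (simp add: flat_pgraph_def)
  have NF: "model_induced_by N F"
    unfolding F_def by (rule two_worlds_induced_by_flat[OF N(2)]) (simp add: N_def S_def)
  \<comment> \<open>The left side does not mention \<open>H\<close>: any two P-graphs inducing
    \<open>K\<close> have transforms with the same order on \<open>K\<close>.\<close>
  have le_star: "le (star K \<phi>) = le_of (dagger H \<phi>) (worlds K) (val K)"
    if "pref_model K" "is_pgraph H" "model_induced_by K H" for K H
  proof -
    have "model_induced_by (star K \<phi>) (dagger H \<phi>)"
      using star(2) that by (simp add: operator_induced_by_def)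
    then show ?thesis
      using star(1) that(1) by (simp add: dynamic_operator_def model_induced_by_def)
  qed
  \<comment> \<open>\<open>star M\<close> and \<open>star N\<close> are not compared directly; the
    link is \<open>dagger G \<phi>\<close>, whose order restricts from \<open>M\<close> to
    \<open>N\<close>.\<close>
  have "(w, w') \<in> le (star M \<phi>) \<longleftrightarrow> (w, w') \<in> le_of (dagger G \<phi>) (worlds N) (val N)"
    using le_star[OF M(1) G] S by (simp add: N_def le_of_restrict[OF S(1)])
  \<comment> \<open>Both \<open>G\<close> and \<open>F\<close> induce \<open>N\<close>, so both
    sides describe \<open>star N \<phi>\<close>.\<close>
  also have "\<dots> \<longleftrightarrow> (w, w') \<in> le_of (dagger F \<phi>) (worlds N) (val N)"
    using le_star[OF N(1) G(1) N(2)] le_star[OF N(1) F(1) NF] by simp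
  also have "\<dots> \<longleftrightarrow> (w, w') \<in> le_of F (worlds N) (val N)"
  proof (rule le_of_flat_transfer[OF F(2)])
    show "\<not> sat (val N) w \<phi>" "\<not> sat (val N) w' \<phi>"
      using neg S by (simp_all add: N_def sat_restrict)
  next
    fix \<xi> assume "\<xi> \<in> fms F"
    then show "\<exists>\<xi>'\<in>fms (dagger F \<phi>). (\<^bold>\<not> \<phi> \<^bold>\<and> \<xi>) \<simeq> (\<^bold>\<not> \<phi> \<^bold>\<and> \<xi>')"
      using assms(3)[OF F(1)] by blast
  next
    fix \<xi> assume "\<xi> \<in> fms (dagger F \<phi>)"
    then show "\<xi> \<simeq> \<phi> \<or> (\<exists>\<xi>'\<in>fms F. (\<^bold>\<not> \<phi> \<^bold>\<and> \<xi>) \<simeq> (\<^bold>\<not> \<phi> \<^bold>\<and> \<xi>') \<and>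
        (\<forall>\<psi>\<in>fms (dagger F \<phi>). (\<psi>, \<xi>) \<in> prec (dagger F \<phi>) \<longrightarrow> \<psi> \<simeq> \<phi>))"
      using assms(4)[OF F(1)] F(2) by blast
  qed
  also have "\<dots> \<longleftrightarrow> (w, w') \<in> le N"
    using NF by (simp add: model_induced_by_def)
  also have "\<dots> \<longleftrightarrow> (w, w') \<in> le M"
    using S by (simp add: N_def)
  finally show "(w, w') \<in> le (star M \<phi>) \<longleftrightarrow> (w, w') \<in> le M" .
qed

end
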